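(* Let $X=M/A$ be the quotient space of a metrizable space $M$ by a closed nowhere dense subset $A\subset M$. If the function space $C_k(X)$ is Suslin, then the space $M$ is $\sigma$-compact and hence $X$ is an $F_\sigma$-quotient space.
   Context: $M/A$ denotes the quotient space of $M$ obtained by collapsing $A$ to a single point, with the quotient topology. $C_k(X)$ is the set $C(X)$ of continuous real-valued functions on $X$ with the compact-open topology, generated by the subbase of sets $\{f\in C(X):\min f(K)>r\}$ and $\{f\in C(X):\max f(K)<r\}$, where $K\subset X$ is nonempty compact and $r\in\mathbb{R}$. A topological space is Polish if it is homeomorphic to a separable complete metric space; it is Suslin if it is the image of a Polish space under a continuous map. A space $X$ is $F_\sigma$-quotient if there is a surjective quotient map $Z\to X$ from a subspace $Z$ of some compact metrizable space $K$ such that $Z$ is an $F_\sigma$-set (a countable union of closed sets) in $K$; equivalently, $X$ is a quotient of a $\sigma$-compact metrizable space. *)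

theory Defs
  imports "HOL-Analysis.Analysis"
begin

section \<open>Collapsing a subset to a point\<close>

text \<open>The points of \<open>M/A\<close> are the classes of the equivalence relation below: the set \<open>A\<close> and the
  singletons of the points outside \<open>A\<close>.  For \<open>A = {}\<close> no point is added, so \<open>M/{}\<close> is a copy
  of \<open>M\<close>.\<close>

definition collapse_rel :: "'a topology \<Rightarrow> 'a set \<Rightarrow> ('a \<times> 'a) set" where
  "collapse_rel M A =
     {(x, y). x \<in> topspace M \<and> y \<in> topspace M \<and> (x = y \<or> (x \<in> A \<and> y \<in> A))}"

definition collapse_space :: "'a topology \<Rightarrow> 'a set \<Rightarrow> 'a set topology" where
  "collapse_space M A =
     topology (\<lambda>U. U \<subseteq> topspace M // collapse_rel M A \<and> openin M (\<Union>U))"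

definition nowhere_dense_in :: "'a topology \<Rightarrow> 'a set \<Rightarrow> bool" where
  "nowhere_dense_in M A \<longleftrightarrow> A \<subseteq> topspace M \<and> M interior_of (M closure_of A) = {}"

lemma equiv_collapse_rel: "equiv (topspace M) (collapse_rel M A)"
  by (auto intro!: equivI refl_onI symI transI simp: collapse_rel_def)

lemma openin_collapse_space:
  "openin (collapse_space M A) U \<longleftrightarrow>
     U \<subseteq> topspace M // collapse_rel M A \<and> openin M (\<Union>U)"
proof -
  let ?Q = "topspace M // collapse_rel M A"
  have disj: "\<Union>(S \<inter> T) = \<Union>S \<inter> \<Union>T" if "S \<subseteq> ?Q" "T \<subseteq> ?Q" for S T
  proof
    show "\<Union>S \<inter> \<Union>T \<subseteq> \<Union>(S \<inter> T)"
    proof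
      fix x assume "x \<in> \<Union>S \<inter> \<Union>T"
      then obtain s t where st: "s \<in> S" "t \<in> T" "x \<in> s" "x \<in> t" by blast
      then have "s = t"
        using quotient_disj[OF equiv_collapse_rel, of s M A t] that by blast
      with st show "x \<in> \<Union>(S \<inter> T)" by blast
    qed
  qed blast
  have "istopology (\<lambda>U. U \<subseteq> ?Q \<and> openin M (\<Union>U))"
    unfolding istopology_def
  proof (intro conjI allI impI)
    fix S T assume "S \<subseteq> ?Q \<and> openin M (\<Union>S)" "T \<subseteq> ?Q \<and> openin M (\<Union>T)"
    then show "S \<inter> T \<subseteq> ?Q" "openin M (\<Union>(S \<inter> T))" by (auto simp: disj)
  next
    fix \<K> assume K: "\<forall>K\<in>\<K>. K \<subseteq> ?Q \<and> openin M (\<Union>K)"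
    then show "\<Union>\<K> \<subseteq> ?Q" by blast
    have "\<Union>(\<Union>\<K>) = \<Union>(Union ` \<K>)" by blast
    with K show "openin M (\<Union>(\<Union>\<K>))" by auto
  qed
  then show ?thesis
    by (simp add: collapse_space_def topology_inverse')
qed

lemma topspace_collapse_space:
  "topspace (collapse_space M A) = topspace M // collapse_rel M A"
proof
  show "topspace (collapse_space M A) \<subseteq> topspace M // collapse_rel M A"
    by (metis openin_collapse_space openin_topspace)
  have "openin (collapse_space M A) (topspace M // collapse_rel M A)"
    by (simp add: openin_collapse_space Union_quotient[OF equiv_collapse_rel])
  then show "topspace M // collapse_rel M A \<subseteq> topspace (collapse_space M A)"
    by (rule openin_subset)
qed

lemma quotient_map_collapse_space:
  "quotient_map M (collapse_space M A) (\<lambda>x. collapse_rel M A `` {x})"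
  unfolding quotient_map_def
proof (intro conjI allI impI)
  show "(\<lambda>x. collapse_rel M A `` {x}) ` topspace M = topspace (collapse_space M A)"
    by (auto simp: topspace_collapse_space quotient_def)
  fix U assume "U \<subseteq> topspace (collapse_space M A)"
  then have U: "U \<subseteq> topspace M // collapse_rel M A"
    by (simp add: topspace_collapse_space)
  have "{x \<in> topspace M. collapse_rel M A `` {x} \<in> U} = \<Union>U"
  proof (intro set_eqI iffI)
    fix x assume x: "x \<in> {x \<in> topspace M. collapse_rel M A `` {x} \<in> U}"
    then have "x \<in> collapse_rel M A `` {x}" by (simp add: collapse_rel_def)
    with x show "x \<in> \<Union>U" by auto
  next
    fix x assume "x \<in> \<Union>U"
    then obtain u where u: "u \<in> U" "x \<in> u" by auto
    then obtain y where y: "y \<in> topspace M" "u = collapse_rel M A `` {y}"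
      using U by (auto elim!: quotientE)
    then have yx: "(y, x) \<in> collapse_rel M A" using u by simp
    then have "u = collapse_rel M A `` {x}"
      using equiv_class_eq[OF equiv_collapse_rel] y(2) by simp
    moreover have "x \<in> topspace M" using yx by (simp add: collapse_rel_def)
    ultimately show "x \<in> {x \<in> topspace M. collapse_rel M A `` {x} \<in> U}"
      using u by simp
  qed
  with U show "openin M {x \<in> topspace M. collapse_rel M A `` {x} \<in> U} \<longleftrightarrow>
      openin (collapse_space M A) U"
    by (simp add: openin_collapse_space)
qed

section \<open>The compact-open topology\<close>

text \<open>A function on the space \<open>X\<close> is represented by its extension with value \<open>undefined\<close> outside
  \<open>topspace X\<close>, so that distinct HOL functions are distinct elements of \<open>C(X)\<close>.\<close>

definition cont_funs :: "'b topology \<Rightarrow> ('b \<Rightarrow> real) set" where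
  "cont_funs X = {f. continuous_map X euclideanreal f \<and> f \<in> extensional (topspace X)}"

text \<open>The infimum and the supremum are attained because \<open>K\<close> is compact and nonempty.  The whole
  set \<open>C(X)\<close> belongs to the generated topology as the empty intersection; it has to be inserted
  explicitly because \<^const>\<open>generate_topology_on\<close> does not include it.  This matters only if
  \<open>X\<close> is empty.\<close>

definition Ck_space :: "'b topology \<Rightarrow> ('b \<Rightarrow> real) topology" where
  "Ck_space X = topology_generated_by
     (insert (cont_funs X)
       ({{f \<in> cont_funs X. (INF x\<in>K. f x) > r} | K r. compactin X K \<and> K \<noteq> {}} \<union>
        {{f \<in> cont_funs X. (SUP x\<in>K. f x) < r} | K r. compactin X K \<and> K \<noteq> {}}))"

lemma topspace_Ck_space: "topspace (Ck_space X) = cont_funs X"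
  unfolding Ck_space_def by auto

lemma Ck_subbase_iff:
  assumes "compactin X K" "K \<noteq> {}" "f \<in> cont_funs X"
  shows "(INF x\<in>K. f x) > r \<longleftrightarrow> (\<forall>x\<in>K. f x > r)"
    and "(SUP x\<in>K. f x) < r \<longleftrightarrow> (\<forall>x\<in>K. f x < r)"
proof -
  have c: "compact (f ` K)"
    using assms image_compactin[of X K euclideanreal f] by (simp add: cont_funs_def)
  have ne: "f ` K \<noteq> {}" using assms by simp
  have bdd: "bdd_below (f ` K)" "bdd_above (f ` K)"
    using compact_imp_bounded[OF c]
    by (auto intro: bounded_imp_bdd_above bounded_imp_bdd_below)
  have "Inf (f ` K) \<in> f ` K" "Sup (f ` K) \<in> f ` K"
    using closed_contains_Inf[OF ne bdd(1)] closed_contains_Sup[OF ne bdd(2)]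
      compact_imp_closed[OF c] by auto
  moreover have "Inf (f ` K) \<le> f x" "f x \<le> Sup (f ` K)" if "x \<in> K" for x
    using that bdd by (simp_all add: cInf_lower cSup_upper)
  ultimately show "(INF x\<in>K. f x) > r \<longleftrightarrow> (\<forall>x\<in>K. f x > r)" "(SUP x\<in>K. f x) < r \<longleftrightarrow> (\<forall>x\<in>K. f x < r)"
    by (metis (no_types, lifting) imageE order_less_le_trans,
        metis (no_types, lifting) imageE order_le_less_trans)
qed

section \<open>Polish, Suslin, \<open>\<sigma>\<close>-compact and \<open>F\<^sub>\<sigma>\<close>-quotient spaces\<close>

definition Polish_space :: "'a topology \<Rightarrow> bool" where
  "Polish_space P \<longleftrightarrow> completely_metrizable_space P \<and> separable_space P"

text \<open>A HOL formula cannot quantify over types.  As separable metrizable spaces have at most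
  continuum many points, each is homeomorphic to a topology on a subset of the type \<^typ>\<open>real\<close>.
  Quantifying over the topologies on this type is therefore no restriction; see
  \<open>Suslin_spaceI\<close> and \<open>Fsigma_quotient_spaceI\<close>.  The usual topology of \<^typ>\<open>real\<close> plays
  no role here.\<close>

definition Suslin_space :: "'a topology \<Rightarrow> bool" where
  "Suslin_space Y \<longleftrightarrow>
     (\<exists>(P :: real topology) f. Polish_space P \<and> continuous_map P Y f \<and>
        f ` topspace P = topspace Y)"

definition sigma_compact_space :: "'a topology \<Rightarrow> bool" where
  "sigma_compact_space X \<longleftrightarrow>
     (\<exists>\<K>. countable \<K> \<and> (\<forall>K\<in>\<K>. compactin X K) \<and> \<Union>\<K> = topspace X)"

definition Fsigma_quotient_space :: "'a topology \<Rightarrow> bool" where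
  "Fsigma_quotient_space X \<longleftrightarrow>
     (\<exists>(K :: real topology) Z q. compact_space K \<and> metrizable_space K \<and> fsigma_in K Z \<and>
        quotient_map (subtopology K Z) X q)"

lemma separable_metrizable_lepoll_reals:
  assumes "metrizable_space X" "separable_space X"
  shows "topspace X \<lesssim> (UNIV :: real set)"
proof -
  obtain S d where "Metric_space S d" and X: "X = Metric_space.mtopology S d"
    using assms(1) by (auto simp: metrizable_space_def)
  then interpret Metric_space S d by simp
  obtain C where C: "countable C" "C \<subseteq> S" "mtopology closure_of C = S"
    using assms(2) by (auto simp: separable_space_def X)
  define \<phi> where
    "\<phi> x = {prod_encode (i, n) | i n. d (from_nat_into C i) x < inverse (Suc n)}" for x
  have phi: "prod_encode (i, n) \<in> \<phi> x \<longleftrightarrow> d (from_nat_into C i) x < inverse (Suc n)" for i n x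
    by (auto simp: \<phi>_def)
  have "inj_on \<phi> S"
  proof (rule inj_onI, rule ccontr)
    fix x y assume xy: "x \<in> S" "y \<in> S" "\<phi> x = \<phi> y" "x \<noteq> y"
    then have "d x y / 2 > 0" by simp
    then obtain n where n: "inverse (real (Suc n)) < d x y / 2"
      using reals_Archimedean by blast
    have "x \<in> mtopology closure_of C" using C xy by simp
    then obtain c where c: "c \<in> C" "c \<in> mball x (inverse (real (Suc n)))"
      unfolding metric_closure_of by (auto dest!: spec[of _ "inverse (real (Suc n))"])
    then obtain i where i: "c = from_nat_into C i"
      using from_nat_into_surj[OF C(1) c(1)] by auto
    have "d c x < inverse (Suc n)" using c by (simp add: commute)
    moreover from this have "d c y < inverse (Suc n)"
      using xy(3) phi[of i n x] phi[of i n y] i by simp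
    moreover have "d x y \<le> d c x + d c y"
      using triangle[of x c y] xy c C commute by auto
    ultimately show False using n by simp
  qed
  then have "S \<lesssim> (UNIV :: nat set set)"
    by (auto simp: lepoll_def)
  then show ?thesis
    using lepoll_trans[OF _ eqpoll_imp_lepoll[OF nat_sets_eqpoll_reals]] by (simp add: X)
qed

lemma homeomorphic_topology_on_reals:
  assumes "metrizable_space X" "separable_space X"
  obtains Y :: "real topology" and h where "homeomorphic_map Y X h"
proof -
  obtain g :: "'a \<Rightarrow> real" where g: "inj_on g (topspace X)"
    using separable_metrizable_lepoll_reals[OF assms] by (auto simp: lepoll_def)
  define h where "h = inv_into (topspace X) g"
  define Y where "Y = pullback_topology (g ` topspace X) h X"
  have bij: "bij_betw h (g ` topspace X) (topspace X)"
    unfolding h_def using g by (simp add: bij_betw_inv_into inj_on_imp_bij_betw)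
  have topY: "topspace Y = g ` topspace X"
    using bij by (auto simp: Y_def topspace_pullback_topology bij_betw_def)
  have "homeomorphic_map Y X h"
  proof (rule bijective_open_imp_homeomorphic_map)
    show "continuous_map Y X h"
      unfolding Y_def using continuous_map_pullback[OF continuous_map_id] by fastforce
    show "open_map Y X h"
      unfolding open_map_def
    proof (intro allI impI)
      fix V assume "openin Y V"
      then obtain U where U: "openin X U" "V = h -` U \<inter> g ` topspace X"
        by (auto simp: Y_def openin_pullback_topology)
      have "h ` V = U \<inter> h ` g ` topspace X" unfolding U(2) by auto
      also have "\<dots> = U"
        using bij_betw_imp_surj_on[OF bij] openin_subset[OF U(1)] by (simp add: Int_absorb2)
      finally have "h ` V = U" .
      then show "openin X (h ` V)" using U by simp
    qed
    show "h ` topspace Y = topspace X" "inj_on h (topspace Y)"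
      using bij by (auto simp: topY bij_betw_def)
  qed
  then show thesis by (rule that)
qed

lemma Suslin_spaceI:
  assumes "Polish_space P" "continuous_map P Y f" "f ` topspace P = topspace Y"
  shows "Suslin_space Y"
proof -
  have "metrizable_space P" "separable_space P"
    using assms(1) by (auto simp: Polish_space_def completely_metrizable_imp_metrizable_space)
  then obtain Q :: "real topology" and h where h: "homeomorphic_map Q P h"
    by (rule homeomorphic_topology_on_reals)
  then have "Q homeomorphic_space P"
    by (rule homeomorphic_map_imp_homeomorphic_space)
  then have "Polish_space Q"
    using assms(1) homeomorphic_completely_metrizable_space homeomorphic_separable_space
    unfolding Polish_space_def by blast
  moreover have "continuous_map Q Y (f \<circ> h)"
    using h assms(2) continuous_map_compose homeomorphic_imp_continuous_map by blast
  moreover have "(f \<circ> h) ` topspace Q = topspace Y"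
    using homeomorphic_imp_surjective_map[OF h] assms(3) by (metis image_comp)
  ultimately show ?thesis unfolding Suslin_space_def by blast
qed

lemma compact_metrizable_imp_separable_space:
  assumes "compact_space K" "metrizable_space K"
  shows "separable_space K"
proof -
  obtain S d where "Metric_space S d" and K: "K = Metric_space.mtopology S d"
    using assms(2) by (auto simp: metrizable_space_def)
  then interpret Metric_space S d by simp
  have "mtotally_bounded S"
    using assms(1) K compact_space_eq_mcomplete_mtotally_bounded by blast
  then have "\<exists>F. finite F \<and> F \<subseteq> S \<and> S \<subseteq> (\<Union>x\<in>F. mball x (inverse (Suc n)))" for n
    unfolding mtotally_bounded_def by simp
  then obtain F where F: "\<And>n. finite (F n)" "\<And>n. F n \<subseteq> S"
      "\<And>n. S \<subseteq> (\<Union>x\<in>F n. mball x (inverse (Suc n)))"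
    by metis
  have "mtopology closure_of (\<Union>n. F n) = S"
  proof
    show "S \<subseteq> mtopology closure_of (\<Union>n. F n)"
    proof
      fix x assume x: "x \<in> S"
      have "\<exists>y\<in>\<Union>n. F n. y \<in> mball x r" if r: "r > 0" for r
      proof -
        obtain n where n: "inverse (real (Suc n)) < r"
          using reals_Archimedean[OF r] by blast
        obtain y where "y \<in> F n" "x \<in> mball y (inverse (Suc n))" using F(3)[of n] x by auto
        then have "y \<in> mball x r" using n by (auto simp: commute)
        with \<open>y \<in> F n\<close> show ?thesis by blast
      qed
      with x show "x \<in> mtopology closure_of (\<Union>n. F n)"
        by (simp add: metric_closure_of)
    qed
    show "mtopology closure_of (\<Union>n. F n) \<subseteq> S"
      using closure_of_subset_topspace[of mtopology "\<Union>n. F n"] by simp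
  qed
  then show ?thesis
    unfolding separable_space_def K using F
    by (intro exI[of _ "\<Union>n. F n"]) (auto simp: countable_finite)
qed

lemma Fsigma_quotient_spaceI:
  assumes "compact_space K" "metrizable_space K" "fsigma_in K Z"
    and q: "quotient_map (subtopology K Z) X q"
  shows "Fsigma_quotient_space X"
proof -
  obtain L :: "real topology" and h where h: "homeomorphic_map L K h"
    using homeomorphic_topology_on_reals compact_metrizable_imp_separable_space assms(1,2) by blast
  then have hom: "L homeomorphic_space K"
    by (rule homeomorphic_map_imp_homeomorphic_space)
  define W where "W = {x \<in> topspace L. h x \<in> Z}"
  have hW: "h ` W = Z"
    using homeomorphic_imp_surjective_map[OF h] fsigma_in_subset[OF assms(3)]
    by (auto simp: W_def)
  have "fsigma_in L W"
    using homeomorphic_map_fsigmaness[OF h, of W] assms(3) hW by (simp add: W_def)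
  moreover have "quotient_map (subtopology L W) X (q \<circ> h)"
  proof (rule quotient_map_compose[OF _ q])
    have "h ` (topspace L \<inter> W) = topspace K \<inter> Z"
      using homeomorphic_imp_surjective_map[OF h] by (auto simp: W_def)
    then show "quotient_map (subtopology L W) (subtopology K Z) h"
      using homeomorphic_map_subtopologies[OF h] by (simp add: homeomorphic_map_def)
  qed
  moreover have "compact_space L" "metrizable_space L"
    using hom assms(1,2) homeomorphic_compact_space homeomorphic_metrizable_space by blast+
  ultimately show ?thesis unfolding Fsigma_quotient_space_def by blast
qed

end

theory Submission
  imports Defs
begin

text \<open>
  Let a Polish space \<open>P\<close> be mapped continuously onto the function space of \<open>X = M/A\<close>.  Evaluation at a point is
  continuous, so composing with the quotient map gives a separately continuous function
  \<open>F\<close> on \<open>P \<times> M\<close> such that every continuous function on \<open>M\<close> vanishing on \<open>A\<close> occurs as some \<open>F p\<close>.  Everything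
  is derived from this (\<open>vanishing_parametrization_collapse\<close>).

  A second countable parameter space cannot separate uncountably many bump functions supported off \<open>A\<close>,
  so \<open>M - A\<close> is separable, and hence so is \<open>M\<close>, as \<open>A\<close> is nowhere dense (\<open>separable_if_parametrized\<close>).
  Therefore \<open>M\<close> may be regarded as a subset of a compact metrizable space \<open>K\<close>
  (\<open>metrizable_separable_cube_embedding\<close>).  It remains to see that \<open>M\<close> is an \<open>F\<^sub>\<sigma>\<close>-set there: then it is
  \<open>\<sigma>\<close>-compact, and \<open>X\<close> is by definition a quotient of an \<open>F\<^sub>\<sigma>\<close>-set in \<open>K\<close>.

  A compact set \<open>C\<close> disjoint from \<open>M\<close> is encoded by a function on \<open>M\<close> that vanishes on \<open>A\<close> but tends to infinity
  along those points of suitable finite nets \<open>D n \<subseteq> M - A\<close> that approach \<open>C\<close>.  The nets approach every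
  point of \<open>M\<close>, including those of \<open>A\<close>, because \<open>M - A\<close> is dense.  So no function continuous on \<open>M\<close>
  can encode a set meeting \<open>M\<close>.  As the encoding uses only values at single points, it is a closed relation
  between parameters and points (\<open>fsigma_if_parametrized\<close>): the compact sets disjoint from \<open>M\<close> are
  dominated by a Polish space.  By a theorem of Christensen such a domination makes the complement
  of \<open>M\<close> a \<open>G\<^sub>\<delta>\<close>-set (\<open>fsigma_if_compacts_in_closed_sections\<close>).
\<close>

section \<open>Separable metrizable and \<open>\<sigma>\<close>-compact spaces\<close>

lemma metrizable_separable_imp_second_countable:
  assumes "metrizable_space X" "separable_space X"
  shows "second_countable X"
proof -
  obtain S d where "Metric_space S d" and X: "X = Metric_space.mtopology S d"
    using assms(1) by (auto simp: metrizable_space_def)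
  then interpret Metric_space S d by simp
  obtain C where C: "countable C" "C \<subseteq> S" "mtopology closure_of C = S"
    using assms(2) by (auto simp: separable_space_def X)
  define \<B> where "\<B> = (\<lambda>(c, n). mball c (inverse (real (Suc n)))) ` (C \<times> UNIV)"
  have "\<exists>V\<in>\<B>. x \<in> V \<and> V \<subseteq> U" if U: "openin mtopology U" "x \<in> U" for U x
  proof -
    obtain r where r: "r > 0" "mball x r \<subseteq> U" and x: "x \<in> S"
      using U unfolding openin_mtopology by blast
    obtain n where n: "inverse (real (Suc n)) < r / 2"
      using reals_Archimedean[of "r / 2"] r by auto
    have "x \<in> mtopology closure_of C" using C x by simp
    then obtain c where c: "c \<in> C" "c \<in> mball x (inverse (real (Suc n)))"
      unfolding metric_closure_of by (auto dest!: spec[of _ "inverse (real (Suc n))"])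
    have "mball c (inverse (real (Suc n))) \<subseteq> mball x r"
    proof
      fix z assume z: "z \<in> mball c (inverse (real (Suc n)))"
      have "d x z \<le> d x c + d c z" using z c x by (intro triangle) auto
      with z c n x show "z \<in> mball x r" by auto
    qed
    with r c x show ?thesis
      unfolding \<B>_def by (intro bexI[of _ "mball c (inverse (real (Suc n)))"]) (auto simp: commute)
  qed
  moreover have "countable \<B>" "\<forall>V\<in>\<B>. openin mtopology V"
    using C by (auto simp: \<B>_def)
  ultimately show ?thesis unfolding second_countable_def X by blast
qed

text \<open>The coordinates are the distances, cut off at \<open>1\<close>, to the points of a countable dense set.
  A point is determined by these numbers, and a coordinate belonging to a dense point close to \<open>x\<close>
  is small only near \<open>x\<close>; hence the image of an open set is relatively open.\<close>

lemma metrizable_separable_cube_embedding: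
  fixes X :: "'a topology"
  assumes "metrizable_space X" "separable_space X"
  obtains e :: "'a \<Rightarrow> nat \<Rightarrow> real" and K where "compact K"
    "e ` topspace X \<subseteq> K" "homeomorphic_map X (top_of_set (e ` topspace X)) e"
proof -
  obtain S d where "Metric_space S d" and XS: "X = Metric_space.mtopology S d"
    using assms(1) by (auto simp: metrizable_space_def)
  then interpret Metric_space S d by simp
  obtain C where C: "countable C" "C \<subseteq> S" "mtopology closure_of C = S"
    using assms(2) by (auto simp: separable_space_def XS)
  define c where "c = from_nat_into C"
  define e where "e x i = min 1 (d (c i) x)" for x and i :: nat
  let ?K = "PiE UNIV (\<lambda>_::nat. {0..1::real})"
  have "compact ?K"
  proof -
    have "compactin (product_topology (\<lambda>_::nat. euclideanreal) UNIV) ?K"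
      unfolding compactin_PiE by simp
    then show ?thesis by (simp add: euclidean_product_topology)
  qed
  moreover have "e ` topspace X \<subseteq> ?K" by (auto simp: e_def)
  moreover have "homeomorphic_map X (top_of_set (e ` topspace X)) e"
  proof (cases "S = {}")
    case True
    then have tX: "topspace X = {}" unfolding XS topspace_mtopology .
    then have "U = {}" if "openin X U" for U using openin_subset[OF that] by simp
    then show ?thesis
      by (intro bijective_open_imp_homeomorphic_map) (auto simp: continuous_map_def open_map_def tX)
  next
    case False
    have "C \<noteq> {}" using C(3) False by (metis closure_of_empty)
    then have cC: "c i \<in> C" for i by (simp add: c_def from_nat_into)
    have cS: "c i \<in> S" for i using cC C(2) by blast
    have approx: "\<exists>i. d (c i) x < r" if x: "x \<in> S" and r: "r > 0" for x r
    proof -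
      have "x \<in> mtopology closure_of C" using C(3) x by simp
      then obtain y where "y \<in> C" "y \<in> mball x r" using r unfolding metric_closure_of by blast
      moreover obtain i where "y = c i"
        unfolding c_def using from_nat_into_surj[OF C(1) \<open>y \<in> C\<close>] by metis
      ultimately have "d (c i) x < r" by (simp add: commute)
      then show ?thesis by blast
    qed
    have sep: "\<exists>W. open W \<and> e x \<in> W \<and> (\<forall>z\<in>S. e z \<in> W \<longrightarrow> z \<in> U)"
      if U: "openin X U" "x \<in> U" for U x
    proof -
      obtain r where r: "r > 0" "mball x r \<subseteq> U" and x: "x \<in> S"
        using U unfolding XS openin_mtopology by blast
      define s where "s = min 1 (r / 2)"
      have s: "s > 0" "s \<le> 1" "s \<le> r / 2" using r by (auto simp: s_def)
      obtain i where i: "d (c i) x < s" using approx[OF x s(1)] by blast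
      let ?W = "{w :: nat \<Rightarrow> real. w i < s}"
      have "open ?W"
        by (intro open_Collect_less continuous_on_product_coordinates continuous_on_const)
      moreover have "e x \<in> ?W" using i s by (simp add: e_def)
      moreover have "z \<in> U" if z: "z \<in> S" "e z \<in> ?W" for z
      proof -
        have "d (c i) z < s" using z s(2) by (auto simp: e_def min_def split: if_splits)
        moreover have "d x z \<le> d x (c i) + d (c i) z" using x z cS by (intro triangle) auto
        ultimately have "d x z < r" using i s(3) commute[of x "c i"] by linarith
        then have "z \<in> mball x r" using x z by simp
        then show ?thesis using r(2) by blast
      qed
      ultimately show ?thesis by blast
    qed
    show ?thesis
    proof (rule bijective_open_imp_homeomorphic_map)
      have "continuous_map X euclideanreal (\<lambda>x. e x i)" for i
      proof -
        have "continuous_map X euclideanreal (\<lambda>x. d (c i) x)"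
        proof -
          let ?m = "metric (S, d)"
          have "continuous_map X (prod_topology (mtopology_of ?m) (mtopology_of ?m)) (\<lambda>x. (c i, x))"
            using cS[of i] unfolding XS mtopology_of by (intro continuous_map_pairedI) simp_all
          from continuous_map_mdist_alt[OF this] show ?thesis by simp
        qed
        then show ?thesis unfolding e_def by (intro continuous_map_real_min continuous_map_const[THEN iffD2]) simp_all
      qed
      then have "continuous_map X euclidean e"
        unfolding euclidean_product_topology[symmetric] continuous_map_componentwise_UNIV by blast
      then show "continuous_map X (top_of_set (e ` topspace X)) e"
        by (simp add: continuous_map_in_subtopology)
      show "e ` topspace X = topspace (top_of_set (e ` topspace X))" by simp
      show "inj_on e (topspace X)"
      proof (rule inj_onI, rule ccontr)
        fix x y assume xy: "x \<in> topspace X" "y \<in> topspace X" "e x = e y" "x \<noteq> y"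
        then have "x \<in> S" "y \<in> S" by (auto simp: XS)
        have "d x y > 0" using xy by (simp add: XS)
        moreover have "openin X (mball x (d x y))" by (simp add: XS)
        moreover have "x \<in> mball x (d x y)" using \<open>x \<in> S\<close> \<open>d x y > 0\<close> by simp
        ultimately obtain W where "e x \<in> W" "\<forall>z\<in>S. e z \<in> W \<longrightarrow> z \<in> mball x (d x y)"
          using sep by blast
        then have "y \<in> mball x (d x y)" using xy(3) \<open>y \<in> S\<close> by auto
        then show False by simp
      qed
      show "open_map X (top_of_set (e ` topspace X)) e"
        unfolding open_map_def
      proof (intro allI impI)
        fix U assume U: "openin X U"
        then obtain W where W: "\<And>x. x \<in> U \<Longrightarrow> open (W x) \<and> e x \<in> W x \<and> (\<forall>z\<in>S. e z \<in> W x \<longrightarrow> z \<in> U)"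
          using sep by metis
        have US: "U \<subseteq> S" using openin_subset[OF U] by (simp add: XS)
        have "e ` U = e ` S \<inter> (\<Union>x\<in>U. W x)"
        proof
          show "e ` U \<subseteq> e ` S \<inter> (\<Union>x\<in>U. W x)" using US W by blast
          show "e ` S \<inter> (\<Union>x\<in>U. W x) \<subseteq> e ` U" using W by blast
        qed
        then have "e ` U = e ` topspace X \<inter> (\<Union>x\<in>U. W x)" by (simp add: XS)
        moreover have "open (\<Union>x\<in>U. W x)" using W by blast
        ultimately show "openin (top_of_set (e ` topspace X)) (e ` U)"
          by (metis openin_open)
      qed
    qed
  qed
  ultimately show thesis by (rule that)
qed

lemma (in Metric_space) maximal_separated_subset:
  obtains E where "E \<subseteq> T" "\<And>x y. x \<in> E \<Longrightarrow> y \<in> E \<Longrightarrow> x \<noteq> y \<Longrightarrow> \<epsilon> \<le> d x y"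
    "\<And>y. y \<in> T \<Longrightarrow> y \<notin> E \<Longrightarrow> \<exists>x\<in>E. d x y < \<epsilon>"
proof -
  let ?A = "{E. E \<subseteq> T \<and> (\<forall>x\<in>E. \<forall>y\<in>E. x \<noteq> y \<longrightarrow> \<epsilon> \<le> d x y)}"
  have "\<exists>E\<in>?A. \<forall>E'\<in>?A. E \<subseteq> E' \<longrightarrow> E' = E"
  proof (rule subset_Zorn')
    fix C assume C: "subset.chain ?A C"
    then have sub: "C \<subseteq> ?A" and lin: "\<And>X Y. X \<in> C \<Longrightarrow> Y \<in> C \<Longrightarrow> X \<subseteq> Y \<or> Y \<subseteq> X"
      by (auto simp: subset_chain_def)
    have "\<epsilon> \<le> d x y" if xy: "x \<in> \<Union>C" "y \<in> \<Union>C" "x \<noteq> y" for x y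
    proof -
      obtain X Y where "X \<in> C" "Y \<in> C" "x \<in> X" "y \<in> Y" using xy by blast
      then obtain Z where "Z \<in> C" "x \<in> Z" "y \<in> Z" using lin by blast
      then show ?thesis using sub xy(3) by blast
    qed
    then show "\<Union>C \<in> ?A" using sub by blast
  qed
  then obtain E where E: "E \<in> ?A" "\<forall>E'\<in>?A. E \<subseteq> E' \<longrightarrow> E' = E" by (rule bexE)
  have "\<exists>x\<in>E. d x y < \<epsilon>" if y: "y \<in> T" "y \<notin> E" for y
  proof (rule ccontr)
    assume "\<not> (\<exists>x\<in>E. d x y < \<epsilon>)"
    then have "insert y E \<in> ?A" using E(1) y(1) commute by (auto simp: not_less)
    then have "insert y E = E" using E(2) by (meson bspec subset_insertI)
    then show False using y(2) by blast
  qed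
  then show thesis using E(1) by (intro that[of E]) auto
qed

lemma fsigma_in_compact_space_imp_sigma_compact:
  assumes "compact_space K" "fsigma_in K Z"
  shows "sigma_compact_space (subtopology K Z)"
proof -
  obtain \<U> where "countable \<U>" "\<And>U. U \<in> \<U> \<Longrightarrow> closedin K U" "\<Union>\<U> = Z"
    using assms(2) by (auto simp: fsigma_in_def union_of_def)
  moreover from this have "compactin (subtopology K Z) U" if "U \<in> \<U>" for U
    using that closedin_compact_space[OF assms(1)] by (auto simp: compactin_subtopology)
  ultimately show ?thesis
    using fsigma_in_subset[OF assms(2)] unfolding sigma_compact_space_def
    by (intro exI[of _ \<U>]) auto
qed

lemma sigma_compact_space_continuous_image:
  assumes "sigma_compact_space X" "continuous_map X Y f" "f ` topspace X = topspace Y"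
  shows "sigma_compact_space Y"
proof -
  obtain \<K> where K: "countable \<K>" "\<forall>K\<in>\<K>. compactin X K" "\<Union>\<K> = topspace X"
    using assms(1) unfolding sigma_compact_space_def by (elim exE conjE) (rule that)
  have "\<Union>((`) f ` \<K>) = topspace Y" using K(3) assms(3) by (metis image_Union)
  moreover have "\<forall>L\<in>(`) f ` \<K>. compactin Y L" using K(2) image_compactin[OF _ assms(2)] by blast
  moreover have "countable ((`) f ` \<K>)" using K(1) by simp
  ultimately show ?thesis
    unfolding sigma_compact_space_def by (intro exI[of _ "(`) f ` \<K>"] conjI)
qed

section \<open>Sets whose complement has its compact subsets dominated by a Polish space\<close>

text \<open>An open set around \<open>y\<close> swallows all but finitely many of the sets \<open>C k\<close>.\<close>

lemma compact_insert_UN_shrinking: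
  fixes y :: "'b::metric_space"
  assumes C: "\<And>k. compact (C k)" "\<And>k. C k \<subseteq> ball y (inverse (real (Suc k)))"
  shows "compact (insert y (\<Union>k. C k))"
proof (rule compactI)
  fix \<U> assume \<U>: "\<forall>U\<in>\<U>. open U" "insert y (\<Union>k. C k) \<subseteq> \<Union>\<U>"
  then obtain U where U: "U \<in> \<U>" "y \<in> U" "open U" by blast
  then obtain e where e: "e > 0" "ball y e \<subseteq> U" by (meson open_contains_ball)
  then obtain N where N: "inverse (real (Suc N)) < e" using reals_Archimedean by blast
  have "compact (\<Union>k\<le>N. C k)" using C by (intro compact_UN) auto
  moreover have "(\<Union>k\<le>N. C k) \<subseteq> \<Union>\<U>" using \<U>(2) by blast
  ultimately obtain \<F> where \<F>: "\<F> \<subseteq> \<U>" "finite \<F>" "(\<Union>k\<le>N. C k) \<subseteq> \<Union>\<F>"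
    using \<U>(1) by (meson compactE)
  have "C k \<subseteq> U" if "\<not> k \<le> N" for k
  proof -
    have "inverse (real (Suc k)) \<le> inverse (real (Suc N))"
      using that by (intro le_imp_inverse_le) auto
    then have "ball y (inverse (real (Suc k))) \<subseteq> ball y e"
      using N by (intro subset_ball) linarith
    with C(2)[of k] e(2) show ?thesis by blast
  qed
  then have "insert y (\<Union>k. C k) \<subseteq> \<Union>(insert U \<F>)" using \<F>(3) U(2) by blast
  with \<F> U show "\<exists>D\<subseteq>\<U>. finite D \<and> insert y (\<Union>k. C k) \<subseteq> \<Union>D"
    by (intro exI[of _ "insert U \<F>"]) auto
qed

text \<open>This is a form of Christensen's theorem: a separable metrizable space whose compact subsets are
  dominated by a Polish parameter space is itself Polish.  Here the space is the complement of \<open>M\<close>,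
  and the compact sets are captured by the sections \<open>Q `` {p}\<close> of a closed relation \<open>Q\<close>.

  Call an open set \<open>V\<close> of parameters good at a point \<open>y\<close> if near \<open>y\<close> all compact subsets of \<open>- M\<close> are
  captured by parameters from \<open>V\<close>.  The set of points at which \<open>V\<close> is good is open.  If
  \<open>y \<notin> M\<close>, goodness passes from \<open>V\<close> to one of its arbitrarily small basic subsets: otherwise each of
  the countably many candidates fails on a compact set, these sets can be chosen to
  shrink to \<open>y\<close>, and their union with \<open>y\<close> is a single compact set that a parameter in \<open>V\<close> has to
  capture.  If \<open>y \<in> M\<close> is a limit of points outside \<open>M\<close>, goodness cannot be passed on for ever,
  because a shrinking sequence of good sets yields a convergent sequence of pairs in \<open>Q\<close> whose
  limit is of the form \<open>(p, y)\<close>, which \<open>Q\<close> excludes.  So apart from its interior, \<open>M\<close> consists of the points at which,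
  for some \<open>V\<close> and some size, goodness of \<open>V\<close> is not inherited; this describes \<open>M\<close> by countably many
  Boolean combinations of open and closed sets.\<close>

theorem fsigma_if_compacts_in_closed_sections:
  fixes M :: "'b::metric_space set" and Q :: "('p \<times> 'b) set"
  assumes P: "Polish_space P"
    and Q: "closedin (prod_topology P euclidean) Q"
    and disj: "\<And>p y. (p, y) \<in> Q \<Longrightarrow> y \<notin> M"
    and cofinal: "\<And>C. compact C \<Longrightarrow> C \<inter> M = {} \<Longrightarrow> \<exists>p\<in>topspace P. C \<subseteq> Q `` {p}"
  shows "fsigma_in euclidean M"
proof -
  obtain S d where "Metric_space S d" and PS: "P = Metric_space.mtopology S d"
    and comp: "Metric_space.mcomplete S d"
    using P by (auto simp: Polish_space_def completely_metrizable_space_def)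
  then interpret Metric_space S d by simp
  have "second_countable P"
    using P by (auto simp: Polish_space_def metrizable_separable_imp_second_countable
        completely_metrizable_imp_metrizable_space)
  then obtain \<B>\<^sub>0 where \<B>\<^sub>0: "countable \<B>\<^sub>0" "\<And>V. V \<in> \<B>\<^sub>0 \<Longrightarrow> openin mtopology V"
      "\<And>U x. openin mtopology U \<Longrightarrow> x \<in> U \<Longrightarrow> \<exists>V\<in>\<B>\<^sub>0. x \<in> V \<and> V \<subseteq> U"
    unfolding second_countable_def PS by metis
  define \<B> where "\<B> = insert S \<B>\<^sub>0"
  have cB: "countable \<B>" and SB: "S \<in> \<B>" using \<B>\<^sub>0 by (auto simp: \<B>_def)
  have openB: "openin mtopology V" if "V \<in> \<B>" for V
    using that \<B>\<^sub>0(2) openin_topspace[of mtopology] by (auto simp: \<B>_def)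
  then have VS: "V \<subseteq> S" if "V \<in> \<B>" for V
    using that openin_subset by fastforce
  define small where "small V n \<longleftrightarrow> (\<forall>p\<in>V. \<forall>q\<in>V. d p q < inverse (real (Suc n)))" for V n
  define good where "good V = {y. \<exists>r>0. \<forall>C. compact C \<longrightarrow> C \<subseteq> ball y r - M \<longrightarrow> (\<exists>p\<in>V. C \<subseteq> Q `` {p})}"
    for V
  define Sub where "Sub V n = {V'\<in>\<B>. V' \<subseteq> V \<and> small V' n}" for V n
  have open_good: "open (good V)" for V
    unfolding open_contains_ball
  proof
    fix y assume "y \<in> good V"
    then obtain r where r: "r > 0"
        "\<And>C. compact C \<Longrightarrow> C \<subseteq> ball y r - M \<Longrightarrow> \<exists>p\<in>V. C \<subseteq> Q `` {p}"
      by (auto simp: good_def)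
    have "z \<in> good V" if "z \<in> ball y (r / 2)" for z
    proof -
      have "ball z (r / 2) \<subseteq> ball y r"
        using that by (metis dist_commute mem_ball dist_triangle_half_r subsetI)
      then have "\<forall>C. compact C \<longrightarrow> C \<subseteq> ball z (r / 2) - M \<longrightarrow> (\<exists>p\<in>V. C \<subseteq> Q `` {p})"
        using r(2) by (meson Diff_mono order_refl order_trans)
      then show ?thesis using r(1) unfolding good_def by (intro CollectI exI[of _ "r / 2"]) auto
    qed
    then show "\<exists>e>0. ball y e \<subseteq> good V" using r(1) by (intro exI[of _ "r / 2"]) auto
  qed
  have cover_Sub: "\<exists>V'\<in>Sub V n. p \<in> V'" if "V \<in> \<B>" "p \<in> V" for V n p
  proof -
    let ?e = "inverse (real (Suc n)) / 2"
    have p: "p \<in> S" using that VS by blast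
    have "openin mtopology (V \<inter> mball p ?e)" using openB that by auto
    moreover have "p \<in> V \<inter> mball p ?e" using that p by simp
    ultimately obtain V' where V': "V' \<in> \<B>\<^sub>0" "p \<in> V'" "V' \<subseteq> V \<inter> mball p ?e"
      using \<B>\<^sub>0(3) by meson
    have "small V' n"
      unfolding small_def
    proof (intro ballI)
      fix a b assume "a \<in> V'" "b \<in> V'"
      then have ab: "a \<in> mball p ?e" "b \<in> mball p ?e" using V'(3) by blast+
      have "d a b \<le> d a p + d p b" using ab by (intro triangle) auto
      with ab commute[of a p] show "d a b < inverse (real (Suc n))" by auto
    qed
    with V' show ?thesis by (auto simp: Sub_def \<B>_def)
  qed
  \<comment> \<open>Points outside \<open>M\<close>: goodness is inherited by small subsets.\<close>
  have refine: "\<exists>V'\<in>Sub V n. y \<in> good V'" if V: "V \<in> \<B>" and y: "y \<in> good V" "y \<notin> M" for V n y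
  proof (rule ccontr)
    assume neg: "\<not> (\<exists>V'\<in>Sub V n. y \<in> good V')"
    obtain r where r: "r > 0"
        "\<And>C. compact C \<Longrightarrow> C \<subseteq> ball y r - M \<Longrightarrow> \<exists>p\<in>V. C \<subseteq> Q `` {p}"
      using y(1) by (auto simp: good_def)
    \<comment> \<open>Capturing the empty set already requires a parameter in \<open>V\<close>.\<close>
    have "\<exists>p. p \<in> V" using r(2)[of "{}"] by auto
    then have Sub_ne: "Sub V n \<noteq> {}" using cover_Sub[OF V] by blast
    have cSub: "countable (Sub V n)" using cB by (simp add: Sub_def)
    define v where "v = from_nat_into (Sub V n)"
    have vSub: "v k \<in> Sub V n" for k using from_nat_into[OF Sub_ne] by (simp add: v_def)
    have "\<exists>C. compact C \<and> C \<subseteq> ball y (min r (inverse (real (Suc k)))) - M \<and>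
        (\<forall>p\<in>v k. \<not> C \<subseteq> Q `` {p})" for k
    proof -
      have "y \<notin> good (v k)" using neg vSub by blast
      moreover have "min r (inverse (real (Suc k))) > 0" using r(1) by simp
      ultimately have "\<not> (\<forall>C. compact C \<longrightarrow> C \<subseteq> ball y (min r (inverse (real (Suc k)))) - M \<longrightarrow>
          (\<exists>p\<in>v k. C \<subseteq> Q `` {p}))"
        unfolding good_def by simp
      then show ?thesis by blast
    qed
    then obtain C where C: "\<And>k. compact (C k)"
        "\<And>k. C k \<subseteq> ball y (min r (inverse (real (Suc k)))) - M"
        "\<And>k p. p \<in> v k \<Longrightarrow> \<not> C k \<subseteq> Q `` {p}"
      by metis
    have "compact (insert y (\<Union>k. C k))"
      using C(1,2) by (intro compact_insert_UN_shrinking) fastforce+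
    moreover have "insert y (\<Union>k. C k) \<subseteq> ball y r - M"
      using C(2) y(2) r(1) by fastforce
    ultimately obtain p where p: "p \<in> V" "insert y (\<Union>k. C k) \<subseteq> Q `` {p}"
      using r(2) by blast
    obtain V' where "V' \<in> Sub V n" "p \<in> V'" using cover_Sub[OF V p(1)] by blast
    then obtain k where "p \<in> v k" using from_nat_into_surj[OF cSub] by (metis v_def)
    then show False using C(3) p(2) by blast
  qed
  \<comment> \<open>Boundary points of \<open>M\<close>: goodness cannot be inherited indefinitely.\<close>
  have chain: False
    if y: "y \<in> M" "y \<in> closure (- M)"
      and step: "\<And>V n. V \<in> \<B> \<Longrightarrow> y \<in> good V \<Longrightarrow> \<exists>V'\<in>Sub V n. y \<in> good V'" for y
  proof -
    have yS: "y \<in> good S"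
      using cofinal unfolding good_def by (auto intro!: exI[of _ 1] simp: PS disjoint_iff subset_eq)
    have "\<exists>V. \<forall>n. (V n \<in> \<B> \<and> y \<in> good (V n)) \<and> V (Suc n) \<in> Sub (V n) n"
    proof (rule dependent_nat_choice)
      show "\<exists>V. V \<in> \<B> \<and> y \<in> good V" using SB yS by blast
      fix V n assume "V \<in> \<B> \<and> y \<in> good V"
      then show "\<exists>V'. (V' \<in> \<B> \<and> y \<in> good V') \<and> V' \<in> Sub V n"
        using step[of V n] unfolding Sub_def by blast
    qed
    then obtain V where V: "\<And>n. V n \<in> \<B> \<and> y \<in> good (V n)" "\<And>n. V (Suc n) \<in> Sub (V n) n"
      by metis
    \<comment> \<open>A single point \<open>z\<close> close to \<open>y\<close> is a compact set that has to be captured.\<close>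
    have "\<exists>p z. p \<in> V n \<and> (p, z) \<in> Q \<and> dist z y < inverse (real (Suc n))" for n
    proof -
      obtain r where r: "r > 0"
          "\<And>C. compact C \<Longrightarrow> C \<subseteq> ball y r - M \<Longrightarrow> \<exists>p\<in>V n. C \<subseteq> Q `` {p}"
        using V(1)[of n] by (auto simp: good_def)
      have "min r (inverse (real (Suc n))) > 0" using r(1) by simp
      then obtain z where z: "z \<in> - M" "dist z y < min r (inverse (real (Suc n)))"
        using y(2) unfolding closure_approachable by blast
      then have "{z} \<subseteq> ball y r - M" by (auto simp: dist_commute)
      then obtain p where "p \<in> V n" "{z} \<subseteq> Q `` {p}" using r(2)[of "{z}"] by auto
      then show ?thesis using z by auto
    qed
    then obtain p z where pz: "\<And>n. p n \<in> V n" "\<And>n. (p n, z n) \<in> Q"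
        "\<And>n. dist (z n) y < inverse (real (Suc n))"
      by metis
    have dec: "V n \<subseteq> V m" if "m \<le> n" for m n
    proof (rule lift_Suc_antimono_le[of V, OF _ that])
      show "V (Suc k) \<subseteq> V k" for k using V(2)[of k] by (simp add: Sub_def)
    qed
    have "MCauchy p"
      unfolding MCauchy_def
    proof (intro conjI allI impI)
      show "range p \<subseteq> S" using pz(1) V(1) VS by blast
      fix e :: real assume "e > 0"
      then obtain N where N: "inverse (real (Suc N)) < e" using reals_Archimedean by blast
      show "\<exists>N. \<forall>n n'. N \<le> n \<longrightarrow> N \<le> n' \<longrightarrow> d (p n) (p n') < e"
      proof (intro exI[of _ "Suc N"] allI impI)
        fix n n' assume "Suc N \<le> n" "Suc N \<le> n'"
        then have "p n \<in> V (Suc N)" "p n' \<in> V (Suc N)" using dec pz(1) by blast+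
        moreover have "small (V (Suc N)) N" using V(2)[of N] by (simp add: Sub_def)
        ultimately show "d (p n) (p n') < e" using N unfolding small_def by fastforce
      qed
    qed
    then obtain q where q: "limitin mtopology p q sequentially"
      using comp unfolding mcomplete_def by blast
    have "z \<longlonglongrightarrow> y"
    proof (rule metric_LIMSEQ_I)
      fix e :: real assume "e > 0"
      then obtain N where N: "inverse (real (Suc N)) < e" using reals_Archimedean by blast
      have "dist (z n) y < e" if "n \<ge> N" for n
      proof -
        have "inverse (real (Suc n)) \<le> inverse (real (Suc N))"
          using that by (intro le_imp_inverse_le) auto
        with N pz(3)[of n] show ?thesis by linarith
      qed
      then show "\<exists>no. \<forall>n\<ge>no. dist (z n) y < e" by blast
    qed
    then have "limitin (prod_topology P euclidean) (\<lambda>n. (p n, z n)) (q, y) sequentially"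
      using q by (simp add: limitin_pairwise PS o_def)
    then have "(q, y) \<in> Q"
      by (rule limitin_closedin[OF _ Q]) (use pz(2) in auto)
    then show False using disj y(1) by blast
  qed
  define L where "L V n = (closure (- M) \<inter> good V) \<inter> - (\<Union>V'\<in>Sub V n. good V')" for V n
  have "M = \<Union>(insert (interior M) ((\<lambda>(V, n). L V n) ` (\<B> \<times> UNIV)))" (is "_ = \<Union>?\<L>")
  proof
    show "M \<subseteq> \<Union>?\<L>"
    proof
      fix y assume y: "y \<in> M"
      show "y \<in> \<Union>?\<L>"
      proof (cases "y \<in> interior M")
        case False
        then have "y \<in> closure (- M)" by (simp add: closure_complement)
        with chain[OF y] obtain V n where "V \<in> \<B>" "y \<in> L V n"
          unfolding L_def by blast
        then show ?thesis by blast
      qed auto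
    qed
    have "y \<in> M" if "V \<in> \<B>" "y \<in> L V n" for V n y
      using refine[of V y n] that by (auto simp: L_def)
    then show "\<Union>?\<L> \<subseteq> M" using interior_subset by fastforce
  qed
  moreover have fL: "fsigma_in euclidean (L V n)" for V n
  proof -
    have "closedin euclidean (- (\<Union>V'\<in>Sub V n. good V'))"
      using open_good by (simp add: closed_def open_UN)
    moreover have "openin euclidean (good V)" using open_good by simp
    ultimately show ?thesis
      unfolding L_def
      by (intro fsigma_in_Int closed_imp_fsigma_in open_imp_fsigma_in metrizable_space_euclidean) auto
  qed
  moreover have "countable ?\<L>" using cB by simp
  moreover have "fsigma_in euclidean (interior M)"
    by (simp add: open_imp_fsigma_in metrizable_space_euclidean)
  then have "fsigma_in euclidean T" if "T \<in> ?\<L>" for T using that fL by auto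
  ultimately show ?thesis using fsigma_in_Union by metis
qed

section \<open>Spaces whose continuous functions are parametrized by a Polish space\<close>

text \<open>This is what a continuous map from \<open>P\<close> onto the space of continuous functions on \<open>X/A\<close>
  provides after composition with the quotient map, if only evaluation at points is retained.
  Functions vanishing on \<open>A\<close> suffice as targets, since they factor through \<open>X/A\<close>.\<close>

definition vanishing_parametrization ::
    "'p topology \<Rightarrow> 'a topology \<Rightarrow> 'a set \<Rightarrow> ('p \<Rightarrow> 'a \<Rightarrow> real) \<Rightarrow> bool" where
  "vanishing_parametrization P X A F \<longleftrightarrow>
     (\<forall>x\<in>topspace X. continuous_map P euclideanreal (\<lambda>p. F p x)) \<and>
     (\<forall>p\<in>topspace P. continuous_map X euclideanreal (F p)) \<and>
     (\<forall>g. continuous_map X euclideanreal g \<and> (\<forall>x\<in>A. g x = 0) \<longrightarrow>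
        (\<exists>p\<in>topspace P. \<forall>x\<in>topspace X. F p x = g x))"

lemma vanishing_parametrization_homeomorphic:
  assumes F: "vanishing_parametrization P X A F" and hom: "homeomorphic_maps X Y e e'"
    and A: "A \<subseteq> topspace X"
  shows "vanishing_parametrization P Y (e ` A) (\<lambda>p y. F p (e' y))"
proof -
  have e: "continuous_map X Y e" and e': "continuous_map Y X e'"
    and inv: "\<And>x. x \<in> topspace X \<Longrightarrow> e' (e x) = x" "\<And>y. y \<in> topspace Y \<Longrightarrow> e (e' y) = y"
    using hom by (auto simp: homeomorphic_maps_def)
  have e'X: "e' y \<in> topspace X" if "y \<in> topspace Y" for y
    using continuous_map_image_subset_topspace[OF e'] that by blast
  have "\<exists>p\<in>topspace P. \<forall>y\<in>topspace Y. F p (e' y) = g y"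
    if g: "continuous_map Y euclideanreal g" "\<forall>y\<in>e ` A. g y = 0" for g
  proof -
    have "continuous_map X euclideanreal (g \<circ> e)" using continuous_map_compose[OF e g(1)] .
    moreover have "\<forall>x\<in>A. (g \<circ> e) x = 0" using g(2) by simp
    ultimately obtain p where p: "p \<in> topspace P" "\<forall>x\<in>topspace X. F p x = (g \<circ> e) x"
      using F unfolding vanishing_parametrization_def by blast
    then have "F p (e' y) = g y" if "y \<in> topspace Y" for y
      using e'X[OF that] inv(2)[OF that] by simp
    then show ?thesis using p(1) by blast
  qed
  moreover have "continuous_map Y euclideanreal (\<lambda>y. F p (e' y))" if "p \<in> topspace P" for p
    using F that continuous_map_compose[OF e', of euclideanreal "F p"]
    unfolding vanishing_parametrization_def by (simp add: o_def)
  moreover have "continuous_map P euclideanreal (\<lambda>p. F p (e' y))" if "y \<in> topspace Y" for y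
    using F e'X[OF that] unfolding vanishing_parametrization_def by blast
  ultimately show ?thesis unfolding vanishing_parametrization_def by blast
qed

text \<open>Functions that are \<open>1\<close> at one point of \<open>D\<close> and \<open>0\<close> at the others and on \<open>A\<close> form a discrete family
  in the topology of pointwise convergence.  Their parameters then form a discrete
  family in \<open>P\<close>, and a countable base leaves room only for countably many.\<close>

lemma countable_if_relatively_discrete:
  assumes P: "second_countable P" and X: "completely_regular_space X"
    and F: "vanishing_parametrization P X A F"
    and D: "D \<subseteq> topspace X - A"
    and disc: "\<And>x. x \<in> D \<Longrightarrow> \<exists>U. openin X U \<and> U \<inter> (A \<union> D) = {x}"
    and A: "A \<subseteq> topspace X"
  shows "countable D"
proof -
  have "\<exists>p\<in>topspace P. F p x = 1 \<and> (\<forall>y\<in>D - {x}. F p y = 0)" if x: "x \<in> D" for x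
  proof -
    obtain U where U: "openin X U" "U \<inter> (A \<union> D) = {x}" using disc[OF x] by blast
    have "closedin X (topspace X - U)" "x \<in> topspace X - (topspace X - U)"
      using U D x by auto
    then obtain f :: "_ \<Rightarrow> real" where f: "continuous_map X (top_of_set {0..1}) f" "f x = 0"
        "f ` (topspace X - U) \<subseteq> {1}"
      using X unfolding completely_regular_space_def by blast
    have Ux: "y = x" if "y \<in> A \<union> D" "y \<in> U" for y
    proof -
      have "y \<in> U \<inter> (A \<union> D)" using that by (rule IntI[rotated])
      then show ?thesis unfolding U(2) by simp
    qed
    have f1: "f y = 1" if "y \<in> topspace X" "y \<notin> U" for y using f(3) that by blast
    have "continuous_map X euclideanreal (\<lambda>y. 1 - f y)"
      using f(1) by (intro continuous_map_diff) (auto simp: continuous_map_in_subtopology)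
    moreover have "\<forall>y\<in>A. 1 - f y = 0"
    proof
      fix y assume y: "y \<in> A"
      then have "y \<noteq> x" using x D by auto
      then have "y \<notin> U" using Ux[of y] y by auto
      then show "1 - f y = 0" using f1[of y] subsetD[OF A y] by simp
    qed
    ultimately obtain p where p: "p \<in> topspace P" "\<forall>y\<in>topspace X. F p y = 1 - f y"
      using F unfolding vanishing_parametrization_def by blast
    have "F p y = 0" if "y \<in> D - {x}" for y
    proof -
      have "y \<notin> U" using Ux[of y] that by auto
      moreover have "y \<in> topspace X" using that D by auto
      ultimately have "f y = 1" by (rule f1[rotated])
      then show ?thesis using p(2) \<open>y \<in> topspace X\<close> by simp
    qed
    moreover have "F p x = 1" using p(2) f(2) D x by auto
    ultimately show ?thesis using p(1) by blast
  qed
  then obtain p where p: "\<And>x. x \<in> D \<Longrightarrow> p x \<in> topspace P" "\<And>x. x \<in> D \<Longrightarrow> F (p x) x = 1"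
      "\<And>x y. x \<in> D \<Longrightarrow> y \<in> D - {x} \<Longrightarrow> F (p x) y = 0"
    by metis
  obtain \<B> where \<B>: "countable \<B>" "\<And>U x. openin P U \<Longrightarrow> x \<in> U \<Longrightarrow> \<exists>V\<in>\<B>. x \<in> V \<and> V \<subseteq> U"
    using P unfolding second_countable_def by metis
  have "\<exists>V\<in>\<B>. p x \<in> V \<and> V \<subseteq> {q \<in> topspace P. F q x > 0}" if x: "x \<in> D" for x
  proof -
    have "continuous_map P euclideanreal (\<lambda>q. F q x)"
      using F D x unfolding vanishing_parametrization_def by blast
    then have "openin P {q \<in> topspace P. F q x > 0}"
      by (simp add: continuous_map_upper_lower_semicontinuous_lt)
    moreover have "p x \<in> {q \<in> topspace P. F q x > 0}" using p x by simp
    ultimately show ?thesis using \<B>(2) by meson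
  qed
  then obtain V where V: "\<And>x. x \<in> D \<Longrightarrow> V x \<in> \<B>" "\<And>x. x \<in> D \<Longrightarrow> p x \<in> V x"
      "\<And>x. x \<in> D \<Longrightarrow> V x \<subseteq> {q \<in> topspace P. F q x > 0}"
    by metis
  \<comment> \<open>\<open>V x\<close> sees only functions positive at \<open>x\<close>, and \<open>p y\<close> with \<open>y \<noteq> x\<close> has value \<open>0\<close> there.\<close>
  have "inj_on V D"
  proof (rule inj_onI, rule ccontr)
    fix x y assume xy: "x \<in> D" "y \<in> D" "V x = V y" "x \<noteq> y"
    then have "F (p x) y > 0" using V(2)[of x] V(3)[of y] by auto
    then show False using p(3)[of x y] xy by simp
  qed
  moreover have "countable (V ` D)" using V(1) \<B>(1) by (meson countable_subset image_subsetI)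
  ultimately show ?thesis by (simp add: countable_image_inj_eq)
qed

text \<open>Maximal \<open>1/(n+1)\<close>-separated subsets of the complement of \<open>A\<close> are relatively discrete, hence countable;
  together they are dense in the complement of \<open>A\<close>, which is dense in \<open>X\<close>.\<close>

lemma separable_if_parametrized:
  assumes X: "metrizable_space X" and A: "closedin X A"
    and dense: "X closure_of (topspace X - A) = topspace X"
    and P: "second_countable P" and F: "vanishing_parametrization P X A F"
  shows "separable_space X"
proof -
  obtain S d where "Metric_space S d" and XS: "X = Metric_space.mtopology S d"
    using X by (auto simp: metrizable_space_def)
  then interpret Metric_space S d by simp
  have AS: "A \<subseteq> S" using closedin_subset[OF A] by (simp add: XS)
  have "\<exists>E. E \<subseteq> S - A \<and> (\<forall>x\<in>E. \<forall>y\<in>E. x \<noteq> y \<longrightarrow> inverse (real (Suc n)) \<le> d x y) \<and>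
      (\<forall>y\<in>S - A. y \<notin> E \<longrightarrow> (\<exists>x\<in>E. d x y < inverse (real (Suc n))))" for n
  proof -
    obtain E where "E \<subseteq> S - A" "\<And>x y. x \<in> E \<Longrightarrow> y \<in> E \<Longrightarrow> x \<noteq> y \<Longrightarrow> inverse (real (Suc n)) \<le> d x y"
        "\<And>y. y \<in> S - A \<Longrightarrow> y \<notin> E \<Longrightarrow> \<exists>x\<in>E. d x y < inverse (real (Suc n))"
      using maximal_separated_subset by metis
    then show ?thesis by (intro exI[of _ E]) simp
  qed
  then obtain E where E: "\<And>n. E n \<subseteq> S - A"
      "\<And>n x y. x \<in> E n \<Longrightarrow> y \<in> E n \<Longrightarrow> x \<noteq> y \<Longrightarrow> inverse (real (Suc n)) \<le> d x y"
      "\<And>n y. y \<in> S - A \<Longrightarrow> y \<notin> E n \<Longrightarrow> \<exists>x\<in>E n. d x y < inverse (real (Suc n))"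
    by metis
  have "countable (E n)" for n
  proof (rule countable_if_relatively_discrete[OF P _ F])
    show "completely_regular_space X"
      using X metrizable_imp_completely_regular_space by blast
    show "E n \<subseteq> topspace X - A" "A \<subseteq> topspace X" using E(1) AS by (auto simp: XS)
    fix x assume x: "x \<in> E n"
    let ?U = "mball x (inverse (real (Suc n))) \<inter> (topspace X - A)"
    have "openin X ?U" using A by (intro openin_Int) (auto simp: XS)
    moreover have "?U \<inter> (A \<union> E n) = {x}"
      using x E(1)[of n] E(2)[OF x] by (force simp: XS)
    ultimately show "\<exists>U. openin X U \<and> U \<inter> (A \<union> E n) = {x}" by blast
  qed
  then have "countable (\<Union>n. E n)" by blast
  moreover have "S - A \<subseteq> X closure_of (\<Union>n. E n)"
  proof
    fix y assume y: "y \<in> S - A"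
    have "\<exists>x\<in>\<Union>n. E n. x \<in> mball y r" if r: "r > 0" for r
    proof -
      obtain n where n: "inverse (real (Suc n)) < r" using reals_Archimedean[OF r] by blast
      show ?thesis
      proof (cases "y \<in> E n")
        case True
        then show ?thesis using y r by (intro bexI[of _ y]) auto
      next
        case False
        then obtain x where "x \<in> E n" "d x y < inverse (real (Suc n))" using E(3) y by blast
        then have "x \<in> mball y r" using n y E(1)[of n] commute[of x y] by auto
        then show ?thesis using \<open>x \<in> E n\<close> by blast
      qed
    qed
    then show "y \<in> X closure_of (\<Union>n. E n)" unfolding XS metric_closure_of using y by blast
  qed
  then have "X closure_of (S - A) \<subseteq> X closure_of (\<Union>n. E n)"
    by (intro closure_of_minimal closedin_closure_of)
  then have "X closure_of (\<Union>n. E n) = topspace X"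
    using dense closure_of_subset_topspace[of X "\<Union>n. E n"] by (simp add: XS)
  moreover have "(\<Union>n. E n) \<subseteq> topspace X" using E(1) by (auto simp: XS)
  ultimately show ?thesis unfolding separable_space_def by blast
qed

text \<open>Near a point with distance \<open>\<rho> > 0\<close> from \<open>C\<close> only those \<open>D n\<close> matter for which \<open>1/(n+1) > \<rho>/2\<close>.
  So the selected points can accumulate only on \<open>C\<close>.\<close>

lemma closed_Un_shrinking_finite:
  fixes C :: "'b::metric_space set"
  assumes C: "closed C" and D: "\<And>n. finite (D n)"
  shows "closed ({x. \<exists>n. x \<in> D n \<and> (\<exists>c\<in>C. dist x c < inverse (real (Suc n)))} \<union> C)"
    (is "closed (?E \<union> C)")
proof (cases "C = {}")
  case ne: False
  show ?thesis
    unfolding closed_limpt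
  proof (intro allI impI, rule ccontr)
    fix z assume z: "z islimpt (?E \<union> C)" and zn: "z \<notin> ?E \<union> C"
    then have zE: "z islimpt ?E"
      using C by (meson UnCI closed_limpt islimpt_Un)
    define \<rho> where "\<rho> = infdist z C"
    have \<rho>: "\<rho> > 0"
      using C ne zn infdist_nonneg[of z C] in_closed_iff_infdist_zero[of C z] by (simp add: \<rho>_def)
    then obtain N where N: "inverse (real (Suc N)) < \<rho> / 2"
      using reals_Archimedean[of "\<rho> / 2"] by auto
    have "?E \<inter> ball z (\<rho> / 2) \<subseteq> (\<Union>n\<le>N. D n)"
    proof
      fix x assume x: "x \<in> ?E \<inter> ball z (\<rho> / 2)"
      then obtain n c where n: "x \<in> D n" "c \<in> C" "dist x c < inverse (real (Suc n))"
        by blast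
      have "\<rho> \<le> dist z x + dist x c"
        unfolding \<rho>_def using n(2) dist_triangle by (rule infdist_le2)
      moreover have "dist z x < \<rho> / 2" using x by simp
      ultimately have "inverse (real (Suc N)) < inverse (real (Suc n))" using n N by linarith
      then have "n \<le> N" by (simp add: inverse_less_iff_less)
      then show "x \<in> (\<Union>n\<le>N. D n)" using n(1) by blast
    qed
    moreover have "finite (\<Union>n\<le>N. D n)" using D by blast
    ultimately have "finite (?E \<inter> ball z (\<rho> / 2))" by (rule finite_subset)
    then show False using zE \<rho> unfolding islimpt_eq_infinite_ball by (meson half_gt_zero)
  qed
qed simp

text \<open>The finite sets \<open>D n \<subseteq> M - A\<close> are \<open>1/(n+1)\<close>-nets of \<open>M\<close>; they exist because \<open>M\<close> is totally bounded
  and \<open>M - A\<close> is dense.  A point \<open>c\<close> is related to the parameter \<open>p\<close> if \<open>F p\<close> is at least \<open>n\<close> at the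
  points of \<open>D n\<close> that are \<open>1/(n+1)\<close>-close to \<open>c\<close>.  Only the values of \<open>F p\<close> at single
  points enter, so this relation is closed.  If \<open>c\<close> were in \<open>M\<close>, the nets would approach \<open>c\<close> and \<open>F p\<close>
  would be unbounded near \<open>c\<close>, contrary to continuity.  Conversely, for a compact set \<open>C\<close> disjoint from \<open>M\<close>, the points of the nets
  that are close to \<open>C\<close> accumulate only on \<open>C\<close>; they form a closed subset \<open>E\<close> of \<open>M\<close> disjoint from \<open>A\<close>,
  and the reciprocal of the distance from \<open>C\<close>, multiplied by a Urysohn function for \<open>A\<close> and \<open>E\<close>, is a
  function vanishing on \<open>A\<close> whose parameter is related to all of \<open>C\<close>.\<close>

lemma fsigma_if_parametrized:
  fixes M A :: "'b::metric_space set"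
  assumes P: "Polish_space P" and K: "compact K" "M \<subseteq> K"
    and A: "closedin (top_of_set M) A" and dense: "M \<subseteq> closure (M - A)"
    and F: "vanishing_parametrization P (top_of_set M) A F"
  shows "fsigma_in euclidean M"
proof -
  have Fp: "\<And>x. x \<in> M \<Longrightarrow> continuous_map P euclideanreal (\<lambda>p. F p x)"
    and Fx: "\<And>p. p \<in> topspace P \<Longrightarrow> continuous_on M (F p)"
    and Fsurj: "\<And>g. continuous_on M g \<Longrightarrow> (\<And>x. x \<in> A \<Longrightarrow> g x = 0) \<Longrightarrow>
        \<exists>p\<in>topspace P. \<forall>x\<in>M. F p x = g x"
    using F by (auto simp: vanishing_parametrization_def)
  have "compact (closure (M - A))"
  proof -
    have "closure (M - A) \<subseteq> K" using K by (intro closure_minimal compact_imp_closed) auto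
    then show ?thesis using compact_Int_closed[OF K(1) closed_closure] by (metis inf.absorb2)
  qed
  have "\<exists>D. finite D \<and> D \<subseteq> M - A \<and> (\<forall>y\<in>M. \<exists>x\<in>D. dist x y < inverse (real (Suc n)))" for n
  proof -
    have "closure (M - A) \<subseteq> (\<Union>x\<in>M - A. ball x (inverse (real (Suc n))))"
    proof
      fix y assume "y \<in> closure (M - A)"
      moreover have "inverse (real (Suc n)) > 0" by simp
      ultimately obtain x where "x \<in> M - A" "dist x y < inverse (real (Suc n))"
        unfolding closure_approachable by blast
      then show "y \<in> (\<Union>x\<in>M - A. ball x (inverse (real (Suc n))))" by auto
    qed
    then obtain D where "D \<subseteq> M - A" "finite D" "closure (M - A) \<subseteq> (\<Union>x\<in>D. ball x (inverse (real (Suc n))))"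
      using compactE_image[OF \<open>compact (closure (M - A))\<close>, of "M - A" "\<lambda>x. ball x (inverse (real (Suc n)))"]
      by (metis open_ball)
    with dense show ?thesis by (intro exI[of _ D]) fastforce
  qed
  then obtain D where D: "\<And>n. finite (D n)" "\<And>n. D n \<subseteq> M - A"
      "\<And>n y. y \<in> M \<Longrightarrow> \<exists>x\<in>D n. dist x y < inverse (real (Suc n))"
    by metis
  define Q where "Q = {(p, c). p \<in> topspace P \<and>
      (\<forall>n. \<forall>x\<in>D n. dist x c < inverse (real (Suc n)) \<longrightarrow> real n \<le> F p x)}"
  show ?thesis
  proof (rule fsigma_if_compacts_in_closed_sections[OF P])
    let ?PE = "prod_topology P (euclidean :: 'b topology)"
    have op: "openin ?PE {z \<in> topspace ?PE. dist x (snd z) < r \<and> F (fst z) x < s}"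
      if "x \<in> M" for x r s
    proof -
      have "continuous_map ?PE euclideanreal (\<lambda>z. F (fst z) x)"
        using continuous_map_compose[OF continuous_map_fst Fp[OF that]] by (simp add: o_def)
      then have "openin ?PE {z \<in> topspace ?PE. F (fst z) x < s}"
        by (simp add: continuous_map_upper_lower_semicontinuous_lt)
      moreover have "openin ?PE {z \<in> topspace ?PE. snd z \<in> ball x r}"
        by (rule openin_continuous_map_preimage[OF continuous_map_snd]) simp
      ultimately have "openin ?PE ({z \<in> topspace ?PE. snd z \<in> ball x r} \<inter>
          {z \<in> topspace ?PE. F (fst z) x < s})" by blast
      also have "\<dots> = {z \<in> topspace ?PE. dist x (snd z) < r \<and> F (fst z) x < s}" by auto
      finally show ?thesis .
    qed
    \<comment> \<open>The open set of pairs violating the condition at the point \<open>x\<close> of the \<open>n\<close>-th net.\<close>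
    define W where "W = (\<lambda>(n, x). {z \<in> topspace ?PE.
        dist x (snd z) < inverse (real (Suc n)) \<and> F (fst z) x < real n})"
    have "openin ?PE (W i)" if "i \<in> Sigma UNIV D" for i
    proof -
      have "snd i \<in> D (fst i)" using that by auto
      then have "snd i \<in> M" using D(2) by blast
      then show ?thesis unfolding W_def case_prod_beta by (rule op)
    qed
    then have "openin ?PE (\<Union>i\<in>Sigma UNIV D. W i)" by blast
    moreover have "Q = topspace ?PE - (\<Union>i\<in>Sigma UNIV D. W i)"
    proof (rule set_eqI)
      fix z
      have "z \<in> Q \<longleftrightarrow> fst z \<in> topspace P \<and> (\<forall>n. \<forall>x\<in>D n. \<not> (dist x (snd z) < inverse (real (Suc n)) \<and> F (fst z) x < real n))"
        unfolding Q_def case_prod_beta not_less[symmetric] by blast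
      also have "\<dots> \<longleftrightarrow> z \<in> topspace ?PE - (\<Union>i\<in>Sigma UNIV D. W i)"
        unfolding W_def case_prod_beta by (auto simp: mem_Times_iff simp del: of_nat_Suc)
      finally show "z \<in> Q \<longleftrightarrow> z \<in> topspace ?PE - (\<Union>i\<in>Sigma UNIV D. W i)" .
    qed
    ultimately show "closedin ?PE Q" by blast
  next
    fix p y assume py: "(p, y) \<in> Q"
    show "y \<notin> M"
    proof
      assume y: "y \<in> M"
      have "continuous_on M (F p)" using py Fx by (simp add: Q_def)
      then obtain \<delta> where \<delta>: "\<delta> > 0" "\<And>x. x \<in> M \<Longrightarrow> dist x y < \<delta> \<Longrightarrow> dist (F p x) (F p y) < 1"
        unfolding continuous_on_iff using y by (meson zero_less_one)
      obtain n1 where n1: "inverse (real (Suc n1)) < \<delta>" using \<delta>(1) reals_Archimedean by blast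
      obtain n2 where n2: "F p y + 1 \<le> real n2" using real_arch_simple by blast
      \<comment> \<open>Close enough for continuity at \<open>y\<close>, and too large for the value there.\<close>
      define n where "n = max n1 n2"
      obtain x where x: "x \<in> D n" "dist x y < inverse (real (Suc n))" using D(3)[OF y] by blast
      have "inverse (real (Suc n)) \<le> inverse (real (Suc n1))"
        by (intro le_imp_inverse_le) (auto simp: n_def)
      then have "dist x y < \<delta>" using x n1 by linarith
      moreover have "x \<in> M" using x D(2) by blast
      ultimately have "dist (F p x) (F p y) < 1" using \<delta>(2) by blast
      moreover have "real n \<le> F p x" using py x by (auto simp: Q_def)
      moreover have "real n2 \<le> real n" by (simp add: n_def)
      ultimately show False using n2 by (auto simp: dist_real_def)
    qed
  next
    fix C :: "'b set" assume C: "compact C" "C \<inter> M = {}"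
    show "\<exists>p\<in>topspace P. C \<subseteq> Q `` {p}"
    proof (cases "C = {}")
      case True
      \<comment> \<open>\<open>infdist\<close> from the empty set is \<open>0\<close>, so its reciprocal is useless here.\<close>
      then show ?thesis using Fsurj[of "\<lambda>_. 0"] by auto
    next
      case ne: False
      define E where "E = {x. \<exists>n. x \<in> D n \<and> (\<exists>c\<in>C. dist x c < inverse (real (Suc n)))}"
      have EM: "E \<subseteq> M - A" using D(2) unfolding E_def by blast
      have infC: "infdist x C > 0" if "x \<notin> C" for x
        using that C ne by (metis compact_imp_closed in_closed_iff_infdist_zero infdist_nonneg
            order_le_less)
      have "closed (E \<union> C)"
        unfolding E_def using C(1) D(1) by (intro closed_Un_shrinking_finite compact_imp_closed)
      moreover have "E = M \<inter> (E \<union> C)" using EM C(2) by blast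
      ultimately have "closedin (top_of_set M) E" by (metis closedin_closed)
      moreover have "normal_space (top_of_set M)"
        by (intro metrizable_imp_normal_space metrizable_space_subtopology metrizable_space_euclidean)
      moreover have "disjnt A E" using EM by (auto simp: disjnt_iff)
      ultimately obtain h where h: "continuous_map (top_of_set M) euclideanreal h"
          "h ` A \<subseteq> {0}" "h ` E \<subseteq> {1}"
        using A Urysohn_lemma_alt by metis
      define g where "g x = h x * inverse (infdist x C)" for x
      have inf0: "infdist x C \<noteq> 0" if "x \<in> M" for x using infC[of x] that C(2) by (metis disjoint_iff less_irrefl)
      have "continuous_on M g"
        unfolding g_def using h(1) inf0 by (auto intro!: continuous_intros)
      moreover have "g x = 0" if "x \<in> A" for x using h(2) that by (auto simp: g_def)
      ultimately obtain p where p: "p \<in> topspace P" "\<And>x. x \<in> M \<Longrightarrow> F p x = g x"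
        using Fsurj by blast
      have "real n \<le> F p x" if "c \<in> C" "x \<in> D n" "dist x c < inverse (real (Suc n))" for c x n
      proof -
        have xM: "x \<in> M" using D(2) that by blast
        have "x \<in> E" using that unfolding E_def by blast
        then have "h x = 1" using h(3) by blast
        have "infdist x C \<le> inverse (real (Suc n))" using that infdist_le2 by (meson less_imp_le)
        then have "inverse (inverse (real (Suc n))) \<le> inverse (infdist x C)"
          using infC[of x] C(2) xM by (intro le_imp_inverse_le) blast+
        then show ?thesis using p(2)[OF xM] \<open>h x = 1\<close> by (simp add: g_def)
      qed
      then have "C \<subseteq> Q `` {p}" using p(1) by (auto simp: Q_def)
      then show ?thesis using p(1) by blast
    qed
  qed
qed

section \<open>The function space of a quotient\<close>

text \<open>Points are compact, so the compact-open topology refines that of pointwise convergence.\<close>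

lemma continuous_map_Ck_eval:
  assumes y: "y \<in> topspace X"
  shows "continuous_map (Ck_space X) euclideanreal (\<lambda>f. f y)"
proof -
  have K: "compactin X {y}" using y by simp
  have "openin (Ck_space X) {f \<in> cont_funs X. f y > r}" for r
    unfolding Ck_space_def
    by (rule topology_generated_by_Basis) (use K in \<open>force intro!: exI[of _ "{y}"]\<close>)
  moreover have "openin (Ck_space X) {f \<in> cont_funs X. f y < r}" for r
    unfolding Ck_space_def
    by (rule topology_generated_by_Basis) (use K in \<open>force intro!: exI[of _ "{y}"]\<close>)
  ultimately show ?thesis
    unfolding continuous_map_upper_lower_semicontinuous_lt topspace_Ck_space by blast
qed

lemma collapse_rel_Image_eqD:
  assumes "x \<in> topspace M" "collapse_rel M A `` {x} = collapse_rel M A `` {y}"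
  shows "x = y \<or> x \<in> A \<and> y \<in> A"
proof -
  have "x \<in> collapse_rel M A `` {y}"
    using assms by (auto simp: collapse_rel_def)
  then show ?thesis by (auto simp: collapse_rel_def)
qed

lemma vanishing_parametrization_collapse:
  assumes \<phi>: "continuous_map P (Ck_space (collapse_space M A)) \<phi>"
      "\<phi> ` topspace P = topspace (Ck_space (collapse_space M A))"
  shows "vanishing_parametrization P M A (\<lambda>p x. \<phi> p (collapse_rel M A `` {x}))"
proof -
  let ?X = "collapse_space M A" and ?q = "\<lambda>x. collapse_rel M A `` {x}"
  note q = quotient_map_collapse_space[of M A]
  have qX: "?q x \<in> topspace ?X" if "x \<in> topspace M" for x
    using quotient_imp_surjective_map[OF q] that by blast
  have "continuous_map P euclideanreal (\<lambda>p. \<phi> p (?q x))" if "x \<in> topspace M" for x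
    using continuous_map_compose[OF \<phi>(1) continuous_map_Ck_eval[OF qX[OF that]]] by (simp add: o_def)
  moreover have "continuous_map M euclideanreal (\<lambda>x. \<phi> p (?q x))" if "p \<in> topspace P" for p
  proof -
    have "\<phi> p \<in> cont_funs ?X" using \<phi>(2) that by (auto simp: topspace_Ck_space)
    then have "continuous_map ?X euclideanreal (\<phi> p)" by (simp add: cont_funs_def)
    then show ?thesis
      using continuous_map_compose[OF quotient_imp_continuous_map[OF q]] by (simp add: o_def)
  qed
  moreover have "\<exists>p\<in>topspace P. \<forall>x\<in>topspace M. \<phi> p (?q x) = g x"
    if g: "continuous_map M euclideanreal g" "\<forall>x\<in>A. g x = 0" for g
  proof -
    obtain h where h: "continuous_map ?X euclideanreal h" "\<And>x. x \<in> topspace M \<Longrightarrow> h (?q x) = g x"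
    proof (rule quotient_map_lift_exists[OF q g(1)])
      show "g x = g y" if "x \<in> topspace M" "?q x = ?q y" for x y
        using collapse_rel_Image_eqD[OF that] g(2) by metis
    qed blast
    have "continuous_map ?X euclideanreal (restrict h (topspace ?X))"
      by (rule continuous_map_eq[OF h(1)]) simp
    then have "restrict h (topspace ?X) \<in> topspace (Ck_space ?X)"
      by (simp add: topspace_Ck_space cont_funs_def)
    then obtain p where "p \<in> topspace P" "\<phi> p = restrict h (topspace ?X)"
      using \<phi>(2) by (metis imageE)
    then show ?thesis using h(2) qX by (intro bexI[of _ p]) simp_all
  qed
  ultimately show ?thesis unfolding vanishing_parametrization_def by blast
qed

theorem proposition1p10:
  fixes M :: "'a topology" and A :: "'a set" and X :: "'a set topology"
  assumes "metrizable_space M"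
    and "closedin M A"
    and "nowhere_dense_in M A"
    and "X = collapse_space M A"
    and "Suslin_space (Ck_space X)"
  shows "sigma_compact_space M \<and> Fsigma_quotient_space X"
proof -
  obtain P :: "real topology" and \<phi> where P: "Polish_space P"
    and \<phi>: "continuous_map P (Ck_space X) \<phi>" "\<phi> ` topspace P = topspace (Ck_space X)"
    using assms(5) unfolding Suslin_space_def by blast
  define F where "F p x = \<phi> p (collapse_rel M A `` {x})" for p x
  have F: "vanishing_parametrization P M A F"
    using vanishing_parametrization_collapse \<phi> unfolding F_def assms(4) by blast
  have A: "A \<subseteq> topspace M" using closedin_subset[OF assms(2)] .
  have "M interior_of A = {}"
    using assms(2,3) by (simp add: nowhere_dense_in_def closure_of_closedin)
  then have dense: "M closure_of (topspace M - A) = topspace M"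
    by (simp add: closure_of_complement)
  have "second_countable P"
    using P by (auto simp: Polish_space_def metrizable_separable_imp_second_countable
        completely_metrizable_imp_metrizable_space)
  then have "separable_space M" by (rule separable_if_parametrized[OF assms(1,2) dense _ F])
  from assms(1) this obtain e :: "'a \<Rightarrow> nat \<Rightarrow> real" and K where K: "compact K" "e ` topspace M \<subseteq> K"
    and hom: "homeomorphic_map M (top_of_set (e ` topspace M)) e"
    by (rule metrizable_separable_cube_embedding)
  define Z where "Z = e ` topspace M"
  note hom = hom[folded Z_def] and K = K[folded Z_def]
  obtain e' where maps: "homeomorphic_maps M (top_of_set Z) e e'"
    using hom homeomorphic_map_maps by blast
  have inj: "inj_on e (topspace M)" using homeomorphic_imp_injective_map[OF hom] .
  have "fsigma_in euclidean Z"
  proof (rule fsigma_if_parametrized[OF P K])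
    show "closedin (top_of_set Z) (e ` A)"
      using homeomorphic_map_closedness[OF hom A] assms(2) by simp
    show "vanishing_parametrization P (top_of_set Z) (e ` A) (\<lambda>p z. F p (e' z))"
      by (rule vanishing_parametrization_homeomorphic[OF F maps A])
    have "top_of_set Z closure_of (e ` (topspace M - A)) = Z"
      using homeomorphic_map_closure_of[OF hom, of "topspace M - A"] dense by (simp add: Z_def)
    moreover have "e ` (topspace M - A) = Z - e ` A"
      using inj A by (simp add: Z_def inj_on_image_set_diff)
    ultimately show "Z \<subseteq> closure (Z - e ` A)"
      by (metis closure_of_subtopology_subset euclidean_closure_of)
  qed
  then have fs: "fsigma_in (top_of_set K) Z"
    using K(2) by (auto simp: fsigma_in_subtopology)
  have cK: "compact_space (top_of_set K)" using K(1) by (simp add: compact_space_subtopology)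
  have ZK: "subtopology (top_of_set K) Z = top_of_set Z"
    using K(2) by (simp add: subtopology_subtopology inf.absorb2)
  have e': "homeomorphic_map (top_of_set Z) M e'" using maps by (simp add: homeomorphic_maps_map)
  have "sigma_compact_space (top_of_set Z)"
    using fsigma_in_compact_space_imp_sigma_compact[OF cK fs] by (simp add: ZK)
  then have "sigma_compact_space M"
    using e' homeomorphic_imp_continuous_map homeomorphic_imp_surjective_map
      sigma_compact_space_continuous_image by metis
  moreover have "quotient_map (subtopology (top_of_set K) Z) X ((\<lambda>x. collapse_rel M A `` {x}) \<circ> e')"
    using e' quotient_map_compose[OF _ quotient_map_collapse_space[of M A]]
    unfolding ZK assms(4) homeomorphic_map_def by blast
  then have "Fsigma_quotient_space X"
    by (rule Fsigma_quotient_spaceI[OF cK metrizable_space_subtopology[OF metrizable_space_euclidean] fs])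
  ultimately show ?thesis by blast
qed

end
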